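(* For every integer $k\ge 3$, we have \[ k!+1 \le f(k) \leq \left(\left\lfloor\frac{k}{2}\right\rfloor+1 \right) k! - \left\lfloor\frac{k}{2}\right\rfloor (k-1)!, \] where $f(k)$ denotes the minimum number of edges in an oriented $k$-graph with Property O.
   Context: An oriented $k$-graph is a pair $\mathcal{H}=(V,\mathcal{E})$, where $V$ is a finite set (the vertex set) and $\mathcal{E}$ (the edge set) is a family of $k$-tuples of elements of $V$ such that no $k$-tuple in $\mathcal{E}$ has a repeated element, and no two $k$-tuples in $\mathcal{E}$ induce the same set (i.e. distinct $k$-tuples in $\mathcal{E}$ have distinct underlying $k$-element subsets of $V$). A tuple $(x_1,x_2,\ldots,x_\ell)$ of distinct elements of $V$ is said to be consistent with a linear order $<$ on $V$ if $x_1<x_2<\cdots<x_\ell$. An oriented $k$-graph $\mathcal{H}=(V,\mathcal{E})$ has Property O if for every linear order $<$ of $V$ there exists an edge $\vec{e}\in\mathcal{E}$ that is consistent with $<$. The function $f$ is defined by \[ f(k) := \min\{|\mathcal{E}| : \text{there exists an oriented } k\text{-graph } \mathcal{H}=(V,\mathcal{E}) \text{ with Property O}\}, \] the minimum being over oriented $k$-graphs on arbitrary finite vertex sets. *)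

theory Defs
  imports Complex_Main
begin

text \<open>Edges are lists, read as tuples. The finiteness of the edge set follows from that of
  the vertex set.\<close>

definition oriented_graph :: "nat \<Rightarrow> 'a set \<Rightarrow> 'a list set \<Rightarrow> bool" where
  "oriented_graph k V E \<longleftrightarrow>
     finite V \<and>
     (\<forall>e\<in>E. length e = k \<and> set e \<subseteq> V \<and> distinct e) \<and>
     (\<forall>e\<in>E. \<forall>e'\<in>E. e \<noteq> e' \<longrightarrow> set e \<noteq> set e')"

definition consistent :: "'a list \<Rightarrow> 'a rel \<Rightarrow> bool" where
  "consistent xs r \<longleftrightarrow> sorted_wrt (\<lambda>x y. (x, y) \<in> r) xs"

text \<open>The predicate \<open>strict_linear_order_on\<close> does not itself confine the relation to
  the vertex set, hence the first premise.\<close>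

definition property_O :: "'a set \<Rightarrow> 'a list set \<Rightarrow> bool" where
  "property_O V E \<longleftrightarrow>
     (\<forall>r. r \<subseteq> V \<times> V \<and> strict_linear_order_on V r \<longrightarrow> (\<exists>e\<in>E. consistent e r))"

text \<open>Vertices are natural numbers without loss of generality: see \<open>min_edges_le_card\<close> below.
  The infimum of a nonempty set of naturals is its minimum; that of the empty set is 0, so a
  positive lower bound on \<open>min_edges k\<close> entails that an oriented graph with Property O exists.\<close>

definition min_edges :: "nat \<Rightarrow> nat" where
  "min_edges k =
     Inf {card E | (V :: nat set) E. oriented_graph k V E \<and> property_O V E}"

lemma min_edges_le_card:
  fixes V :: "'a set"
  assumes G: "oriented_graph k V E" and O: "property_O V E"
  shows "min_edges k \<le> card E"
proof -
  have fin: "finite V" using G by (simp add: oriented_graph_def)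
  have sub: "\<And>e. e \<in> E \<Longrightarrow> set e \<subseteq> V" using G by (simp add: oriented_graph_def)
  obtain h :: "'a \<Rightarrow> nat" where h: "inj_on h V"
    using finite_imp_inj_to_nat_seg[OF fin] by blast
  have G': "oriented_graph k (h ` V) (map h ` E)"
    unfolding oriented_graph_def
  proof (intro conjI ballI impI)
    show "finite (h ` V)" using fin by simp
  next
    fix e assume "e \<in> map h ` E"
    then obtain d where d: "d \<in> E" "e = map h d" by blast
    show "length e = k" using d G by (auto simp: oriented_graph_def)
    show "set e \<subseteq> h ` V" using d sub by auto
    show "distinct e"
      using d G sub[OF d(1)] inj_on_subset[OF h] by (simp add: oriented_graph_def distinct_map)
  next
    fix e e' assume "e \<in> map h ` E" "e' \<in> map h ` E" "e \<noteq> e'"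
    then obtain d d' where d: "d \<in> E" "e = map h d" "d' \<in> E" "e' = map h d'" "d \<noteq> d'" by blast
    have "set d \<noteq> set d'" using d G by (simp add: oriented_graph_def)
    then show "set e \<noteq> set e'"
      using d sub inj_on_image_eq_iff[OF h sub[OF d(1)] sub[OF d(3)]] by simp
  qed
  have O': "property_O (h ` V) (map h ` E)"
    unfolding property_O_def
  proof (intro allI impI, elim conjE)
    fix r assume r: "r \<subseteq> h ` V \<times> h ` V" "strict_linear_order_on (h ` V) r"
    define s where "s = {(x, y). x \<in> V \<and> y \<in> V \<and> (h x, h y) \<in> r}"
    have "s \<subseteq> V \<times> V" by (auto simp: s_def)
    moreover have "trans s"
      using r(2) unfolding strict_linear_order_on_def s_def trans_def by blast
    moreover have "irrefl s"
      using r(2) unfolding strict_linear_order_on_def s_def irrefl_def by blast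
    moreover have "total_on V s"
      using r(2) h unfolding strict_linear_order_on_def s_def total_on_def inj_on_def by blast
    ultimately obtain e where e: "e \<in> E" "consistent e s"
      using O unfolding property_O_def strict_linear_order_on_def by blast
    have "consistent (map h e) r"
      using e(2) unfolding consistent_def sorted_wrt_map
      by (rule sorted_wrt_mono_rel[rotated]) (simp add: s_def)
    then show "\<exists>e\<in>map h ` E. consistent e r" using e(1) by blast
  qed
  have "min_edges k \<le> card (map h ` E)"
    unfolding min_edges_def by (rule cInf_lower) (use G' O' in auto)
  also have "\<dots> \<le> card E"
  proof (rule card_image_le)
    have "E \<subseteq> {xs. set xs \<subseteq> V \<and> length xs = k}" using G by (auto simp: oriented_graph_def)
    then show "finite E" using finite_lists_length_eq[OF fin] finite_subset by blast
  qed
  finally show ?thesis .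
qed

end

(* Lower bound: each edge is consistent with a fraction 1/k! of the orders, so k! edges are needed,
   and with exactly k! of them every order is consistent with exactly one edge. To exclude this,
   fix an edge e = (x1, ..., xk) and sum the number N of consistent edges, with signs, over the
   words of the iterated bracket [x1, [x2, [..., xk]]], the other vertices following in a fixed
   order. The edge e contributes 1. Every other edge misses some xi and contributes 0, since the
   bracket vanishes when a letter is deleted; so does the constant function N = 1.

   Upper bound: take k - 1 base vertices. For each of their orders t there is a pivot; the edge
   consisting of t followed by the pivot settles the case of the pivot being last. If instead
   the pivot lies in one of the other k - 1 gaps of t, the k vertices form a known chain, and
   for a new vertex c the edges obtained by substituting c for a chain entry cover two adjacent
   gaps of the chain each, so k div 2 + 1 of them cover all k + 1 gaps. In total there are
   (k - 1)! (1 + (k - 1) (k div 2 + 1)) edges. *)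

theory Submission
  imports Defs "HOL-Combinatorics.Multiset_Permutations" "HOL-Library.Nat_Bijection"
begin

section \<open>Linear orders as lists\<close>

lemma sorted_wrt_gap:
  assumes r: "strict_linear_order_on V r" and xs: "sorted_wrt (\<lambda>x y. (x, y) \<in> r) xs"
    and V: "set xs \<subseteq> V" "c \<in> V" "c \<notin> set xs"
  obtains g where "g \<le> length xs" "\<And>i. i < g \<Longrightarrow> (xs ! i, c) \<in> r"
    "\<And>i. g \<le> i \<Longrightarrow> i < length xs \<Longrightarrow> (c, xs ! i) \<in> r"
proof
  \<comment> \<open>By transitivity the entries below \<open>c\<close> form an initial segment, so
    \<open>takeWhile\<close> collects all of them.\<close>
  define g where "g = length (takeWhile (\<lambda>x. (x, c) \<in> r) xs)"
  show "g \<le> length xs"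
    by (simp add: g_def length_takeWhile_le)
  show "(xs ! i, c) \<in> r" if "i < g" for i
    using that nth_mem[of i "takeWhile (\<lambda>x. (x, c) \<in> r) xs"]
    by (auto simp: g_def takeWhile_nth dest: set_takeWhileD)
  show "(c, xs ! i) \<in> r" if "g \<le> i" "i < length xs" for i
  proof -
    have g: "g < length xs" "(xs ! g, c) \<notin> r"
      using that nth_length_takeWhile[of "\<lambda>x. (x, c) \<in> r" xs] by (auto simp: g_def)
    have "(c, xs ! g) \<in> r"
      using r g V nth_mem[OF g(1)] unfolding strict_linear_order_on_def total_on_def
      by (metis subsetD)
    moreover have "(xs ! g, xs ! i) \<in> r" if "g \<noteq> i"
      using xs that \<open>g \<le> i\<close> \<open>i < length xs\<close> by (auto simp: sorted_wrt_iff_nth_less)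
    ultimately show ?thesis
      using r unfolding strict_linear_order_on_def by (metis transD)
  qed
qed

lemma sorted_wrt_insert_at:
  assumes "sorted_wrt P xs" "\<And>i. i < g \<Longrightarrow> P (xs ! i) c"
    "\<And>i. g \<le> i \<Longrightarrow> i < length xs \<Longrightarrow> P c (xs ! i)" "g \<le> length xs"
  shows "sorted_wrt P (take g xs @ c # drop g xs)"
proof -
  have "sorted_wrt P (take g xs @ drop g xs)" using assms(1) by simp
  then have "sorted_wrt P (take g xs)" "sorted_wrt P (drop g xs)"
    "\<forall>x\<in>set (take g xs). \<forall>y\<in>set (drop g xs). P x y"
    unfolding sorted_wrt_append by blast+
  moreover have "\<forall>x\<in>set (take g xs). P x c"
    using assms(2,4) by (auto simp: in_set_conv_nth)
  moreover have "\<forall>y\<in>set (drop g xs). P c y"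
    using assms(3,4) by (auto simp: in_set_conv_nth)
  ultimately show ?thesis by (simp add: sorted_wrt_append)
qed

lemma set_take_insert_drop: "set (take g xs @ c # drop g xs) = insert c (set xs)"
proof -
  have "set xs = set (take g xs) \<union> set (drop g xs)"
    by (metis append_take_drop_id set_append)
  then show ?thesis by auto
qed

lemma distinct_take_insert_drop:
  "distinct (take g xs @ c # drop g xs) \<longleftrightarrow> distinct xs \<and> c \<notin> set xs"
proof -
  have "mset (take g xs @ c # drop g xs) = mset (c # take g xs @ drop g xs)"
    by (simp del: append_take_drop_id)
  then have "distinct (take g xs @ c # drop g xs) \<longleftrightarrow> distinct (c # take g xs @ drop g xs)"
    by (rule mset_eq_imp_distinct_iff)
  then show ?thesis by auto
qed

text \<open>Insertion sort, with \<open>sorted_wrt_gap\<close> finding the place of each new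
  element.\<close>

lemma strict_linear_order_sorted_list:
  assumes r: "strict_linear_order_on V r" and S: "finite S" "S \<subseteq> V"
  obtains xs where "set xs = S" "distinct xs" "sorted_wrt (\<lambda>x y. (x, y) \<in> r) xs"
proof -
  have "\<exists>xs. set xs = S \<and> distinct xs \<and> sorted_wrt (\<lambda>x y. (x, y) \<in> r) xs"
    using S
  proof (induction S rule: finite_induct)
    case empty
    show ?case by (rule exI[of _ "[]"]) simp
  next
    case (insert c S)
    then obtain xs where xs: "set xs = S" "distinct xs" "sorted_wrt (\<lambda>x y. (x, y) \<in> r) xs"
      by auto
    have c: "set xs \<subseteq> V" "c \<in> V" "c \<notin> set xs"
      using xs insert by auto
    obtain g where g: "g \<le> length xs" "\<And>i. i < g \<Longrightarrow> (xs ! i, c) \<in> r"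
      "\<And>i. g \<le> i \<Longrightarrow> i < length xs \<Longrightarrow> (c, xs ! i) \<in> r"
      by (rule sorted_wrt_gap[OF r xs(3) c]) blast
    have "sorted_wrt (\<lambda>x y. (x, y) \<in> r) (take g xs @ c # drop g xs)"
      using sorted_wrt_insert_at[OF xs(3), of g c] g by blast
    then show ?case
      using xs c by (metis set_take_insert_drop distinct_take_insert_drop)
  qed
  then show ?thesis using that by blast
qed

lemma sorted_wrt_set_unique:
  assumes "sorted_wrt P xs" "sorted_wrt P ys" "set xs = set ys"
    and "\<And>x y. P x y \<Longrightarrow> \<not> P y x"
  shows "xs = ys"
  using assms(1-3)
proof (induction xs arbitrary: ys)
  case Nil
  then show ?case by simp
next
  case (Cons x xs)
  then obtain y zs where ys: "ys = y # zs" by (cases ys) auto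
  \<comment> \<open>Were the heads different, each would occur in the tail of the other list,
    against asymmetry.\<close>
  have "x = y"
  proof (rule ccontr)
    assume "x \<noteq> y"
    then have "x \<in> set zs" "y \<in> set xs" using Cons.prems ys by auto
    then show False using Cons.prems ys assms(4)[of x y] by simp
  qed
  have irr: "\<not> P x x" using assms(4) by blast
  then have "x \<notin> set xs" "x \<notin> set zs"
    using Cons.prems ys \<open>x = y\<close> by auto
  then have "set xs = set zs" using Cons.prems(3) ys \<open>x = y\<close> by auto
  then show ?case using Cons.IH[of zs] Cons.prems ys \<open>x = y\<close> by simp
qed

text \<open>Translates Property O to permutations: positions in \<open>s\<close> define a linear
  order, and a consistent edge is the subsequence of \<open>s\<close> on its vertices since a set
  has only one increasing enumeration.\<close>

lemma property_O_filter:
  assumes O: "property_O V E" and E: "\<And>e. e \<in> E \<Longrightarrow> set e \<subseteq> V"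
    and s: "s \<in> permutations_of_set V"
  obtains e where "e \<in> E" "filter (\<lambda>x. x \<in> set e) s = e"
proof -
  have V: "set s = V" "distinct s" using s by (auto simp: permutations_of_set_def)
  define r where "r = {(s ! i, s ! j) |i j. i < j \<and> j < length s}"
  have asym: "(y, x) \<notin> r" if "(x, y) \<in> r" for x y
    using that V(2) unfolding r_def by (auto simp: nth_eq_iff_index_eq)
  have "r \<subseteq> V \<times> V" using V unfolding r_def by auto
  moreover have "trans r"
  proof (rule transI)
    fix x y z assume "(x, y) \<in> r" "(y, z) \<in> r"
    then obtain i j j' l where "x = s ! i" "y = s ! j" "y = s ! j'" "z = s ! l"
      "i < j" "j < length s" "j' < l" "l < length s" unfolding r_def by blast
    moreover from this have "j = j'" using V(2) by (simp add: nth_eq_iff_index_eq)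
    ultimately show "(x, z) \<in> r" unfolding r_def using less_trans[of i j l] by blast
  qed
  moreover have "irrefl r" unfolding irrefl_def using asym by blast
  moreover have "total_on V r"
  proof (rule total_onI)
    fix x y assume "x \<in> V" "y \<in> V" "x \<noteq> y"
    then obtain i j where ij: "x = s ! i" "y = s ! j" "i < length s" "j < length s"
      unfolding V(1)[symmetric] in_set_conv_nth by blast
    with \<open>x \<noteq> y\<close> have "i < j \<or> j < i" by (metis nat_neq_iff)
    then show "(x, y) \<in> r \<or> (y, x) \<in> r" using ij unfolding r_def by blast
  qed
  ultimately obtain e where e: "e \<in> E" "consistent e r"
    using O unfolding property_O_def strict_linear_order_on_def by blast
  have "sorted_wrt (\<lambda>x y. (x, y) \<in> r) s"
    unfolding sorted_wrt_iff_nth_less r_def by blast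
  then have "sorted_wrt (\<lambda>x y. (x, y) \<in> r) (filter (\<lambda>x. x \<in> set e) s)"
    by (rule sorted_wrt_filter)
  moreover have "set (filter (\<lambda>x. x \<in> set e) s) = set e"
    using E[OF e(1)] V by auto
  ultimately have "filter (\<lambda>x. x \<in> set e) s = e"
    using sorted_wrt_set_unique[OF _ e(2)[unfolded consistent_def]] asym by blast
  with e(1) show ?thesis using that by blast
qed

section \<open>The lower bound\<close>

lemma card_filter_permutations_le:
  assumes V: "finite V" "S \<subseteq> V" and e: "e \<in> permutations_of_set S" "t \<in> permutations_of_set S"
  shows "card {s \<in> permutations_of_set V. filter (\<lambda>x. x \<in> S) s = e}
       \<le> card {s \<in> permutations_of_set V. filter (\<lambda>x. x \<in> S) s = t}"
proof -
  have et: "set e = S" "distinct e" "set t = S" "distinct t"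
    using e by (auto simp: permutations_of_set_def)
  then have len: "length e = length t" by (metis distinct_card)
  \<comment> \<open>\<open>g\<close> sends the \<open>i\<close>-th entry of \<open>e\<close> to the
    \<open>i\<close>-th entry of \<open>t\<close>; extended by the identity outside
    \<open>S\<close>, it relabels permutations of \<open>V\<close> injectively.\<close>
  define g where "g = (\<lambda>x. t ! (inv_into {..<length e} ((!) e) x))"
  have be: "bij_betw ((!) e) {..<length e} S" and bt: "bij_betw ((!) t) {..<length e} S"
    using et len by (auto intro!: bij_betw_nth)
  have g: "bij_betw g S S"
    unfolding g_def using bij_betw_trans[OF bij_betw_inv_into[OF be] bt] by (simp add: comp_def)
  have "map g e = t"
    by (rule nth_equalityI)
      (use len be in \<open>auto simp: g_def bij_betw_inv_into_left\<close>)
  define f where "f = (\<lambda>x. if x \<in> S then g x else x)"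
  have fe: "map f e = t" using \<open>map g e = t\<close> et by (auto simp: f_def)
  have fS: "f x \<in> S \<longleftrightarrow> x \<in> S" for x
    using g by (auto simp: f_def bij_betw_def)
  have inj: "inj f"
    using g fS unfolding inj_def f_def bij_betw_def inj_on_def by metis
  have "f ` V \<subseteq> V" using g V by (auto simp: f_def bij_betw_def)
  then have fV: "f ` V = V" using V inj by (meson endo_inj_surj inj_on_subset subset_UNIV)
  show ?thesis
  proof (rule card_inj_on_le)
    show "inj_on (map f) {s \<in> permutations_of_set V. filter (\<lambda>x. x \<in> S) s = e}"
      using inj by (meson inj_mapI inj_on_subset subset_UNIV)
    show "map f ` {s \<in> permutations_of_set V. filter (\<lambda>x. x \<in> S) s = e}
        \<subseteq> {s \<in> permutations_of_set V. filter (\<lambda>x. x \<in> S) s = t}"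
      using fe fV inj_on_subset[OF inj subset_UNIV]
      by (auto simp: permutations_of_set_def filter_map comp_def fS distinct_map)
  qed (use V in simp)
qed

text \<open>Restriction to \<open>S\<close> splits the permutations of \<open>V\<close> into
  \<open>fact (card S)\<close> classes, which have equal size by the preceding inequality used in
  both directions.\<close>

lemma fact_mult_card_filter_permutations:
  assumes V: "finite V" "S \<subseteq> V" and e: "e \<in> permutations_of_set S"
  shows "fact (card S) * card {s \<in> permutations_of_set V. filter (\<lambda>x. x \<in> S) s = e}
       = fact (card V)"
proof -
  define C where "C t = {s \<in> permutations_of_set V. filter (\<lambda>x. x \<in> S) s = t}" for t
  have S: "finite S" using V finite_subset by blast
  have "permutations_of_set V = (\<Union>t\<in>permutations_of_set S. C t)"
    using V(2) by (auto simp: C_def permutations_of_set_def)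
  then have "fact (card V) = card (\<Union>t\<in>permutations_of_set S. C t)"
    using card_permutations_of_set[OF V(1)] by simp
  also have "\<dots> = (\<Sum>t\<in>permutations_of_set S. card (C t))"
    by (rule card_UN_disjoint) (use V S in \<open>auto simp: C_def\<close>)
  also have "\<dots> = (\<Sum>t\<in>permutations_of_set S. card (C e))"
    by (rule sum.cong) (auto simp: C_def intro!: antisym card_filter_permutations_le V e)
  also have "\<dots> = fact (card S) * card (C e)"
    using S by simp
  finally show ?thesis by (simp add: C_def)
qed

section \<open>Iterated Lie brackets\<close>

text \<open>The value of \<open>F\<close>, extended linearly, at the Lie bracket \<open>[x1, [x2, [..., xk]]]\<close>
  of the free associative algebra. Deleting a letter amounts to substituting 1 for it, which
  annihilates the bracket.\<close>

fun lie_eval :: "'a list \<Rightarrow> ('a list \<Rightarrow> int) \<Rightarrow> int" where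
  "lie_eval [] F = 0"
| "lie_eval [x] F = F [x]"
| "lie_eval (x # y # xs) F =
     lie_eval (y # xs) (\<lambda>w. F (x # w)) - lie_eval (y # xs) (\<lambda>w. F (w @ [x]))"

text \<open>All words of the bracket are rearrangements of its letters.\<close>

lemma lie_eval_cong:
  assumes "\<And>w. mset w = mset xs \<Longrightarrow> F w = G w"
  shows "lie_eval xs F = lie_eval xs G"
  using assms
proof (induction xs F arbitrary: G rule: lie_eval.induct)
  case (3 x y xs F)
  have "lie_eval (y # xs) (\<lambda>w. F (x # w)) = lie_eval (y # xs) (\<lambda>w. G (x # w))"
    "lie_eval (y # xs) (\<lambda>w. F (w @ [x])) = lie_eval (y # xs) (\<lambda>w. G (w @ [x]))"
    by (rule 3; rule 3; simp)+
  then show ?case by simp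
qed auto

lemma lie_eval_sum: "lie_eval xs (\<lambda>w. \<Sum>e\<in>E. F e w) = (\<Sum>e\<in>E. lie_eval xs (F e))"
  by (induction xs "\<lambda>w. \<Sum>e\<in>E. F e w" arbitrary: F rule: lie_eval.induct)
    (simp_all add: sum_subtractf)

text \<open>If \<open>y\<close> is the outermost letter, the two terms of the commutator agree under
  \<open>F\<close>. Otherwise the inner bracket already vanishes, unless it is the single letter
  \<open>y\<close>; then both words reduce to \<open>[x]\<close>.\<close>

lemma lie_eval_eq_0:
  assumes "2 \<le> length xs" "y \<in> set xs"
    and "\<And>w w'. filter (\<lambda>x. x \<noteq> y) w = filter (\<lambda>x. x \<noteq> y) w' \<Longrightarrow> F w = F w'"
  shows "lie_eval xs F = 0"
  using assms
proof (induction xs F rule: lie_eval.induct)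
  case (3 x z xs F)
  consider "x = y" | "x \<noteq> y" "xs = []" | "x \<noteq> y" "xs \<noteq> []" by blast
  then show ?case
  proof cases
    case 1
    then have "F (x # w) = F (w @ [x])" for w by (intro 3) simp
    then show ?thesis by simp
  next
    case 2
    then have "F [x, z] = F [z, x]" using 3 by (intro 3) auto
    then show ?thesis using 2 by simp
  next
    case 3: 3
    have "2 \<le> length (z # xs)" "y \<in> set (z # xs)"
      using 3 "3.prems" by (auto simp: Suc_le_eq)
    moreover have "F (x # w) = F (x # w')" "F (w @ [x]) = F (w' @ [x])"
      if "filter (\<lambda>x. x \<noteq> y) w = filter (\<lambda>x. x \<noteq> y) w'" for w w'
      using that by (auto intro!: "3.prems"(3))
    ultimately have "lie_eval (z # xs) (\<lambda>w. F (x # w)) = 0"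
      "lie_eval (z # xs) (\<lambda>w. F (w @ [x])) = 0"
      using "3.IH" by blast+
    then show ?thesis by simp
  qed
qed auto

text \<open>Only the positive term of each commutator can yield \<open>xs\<close>: a word ending in
  the first letter would contain it twice.\<close>

lemma lie_eval_self:
  assumes "distinct xs" "xs \<noteq> []"
  shows "lie_eval xs (\<lambda>w. of_bool (w = xs)) = 1"
  using assms
proof (induction xs rule: induct_list012)
  case (3 x y xs)
  have "lie_eval (y # xs) (\<lambda>w. of_bool (w @ [x] = x # y # xs)) = lie_eval (y # xs) (\<lambda>w. 0)"
  proof (rule lie_eval_cong)
    fix w assume "mset w = mset (y # xs)"
    then have "set w = set (y # xs)" by (rule mset_eq_setD)
    then show "of_bool (w @ [x] = x # y # xs) = (0::int)"
      using "3.prems" by (cases w) auto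
  qed
  \<comment> \<open>The zero function is an empty sum, so linearity applies.\<close>
  also have "\<dots> = 0" using lie_eval_sum[of "y # xs" "\<lambda>_ _. 0" "{}"] by simp
  finally show ?case using 3 by simp
qed auto

section \<open>Excluding graphs with at most k! edges\<close>

lemma fact_less_card_edges:
  assumes k: "2 \<le> k" and G: "oriented_graph k V E" and O: "property_O V E"
  shows "fact k < card E"
proof (rule ccontr)
  assume "\<not> fact k < card E"
  then have le: "card E \<le> fact k" by simp
  have V: "finite V" and E: "\<And>e. e \<in> E \<Longrightarrow> length e = k \<and> set e \<subseteq> V \<and> distinct e"
    and inj: "\<And>e e'. e \<in> E \<Longrightarrow> e' \<in> E \<Longrightarrow> e \<noteq> e' \<Longrightarrow> set e \<noteq> set e'"
    using G by (auto simp: oriented_graph_def)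
  have finE: "finite E"
    by (rule finite_subset[OF _ finite_lists_length_eq[OF V, of k]]) (use E in auto)
  \<comment> \<open>A permutation \<open>s\<close> stands for a linear order, and an edge is
    consistent with it iff the filter returns that edge.\<close>
  define N where "N s = (\<Sum>e\<in>E. of_bool (filter (\<lambda>x. x \<in> set e) s = e) :: nat)" for s
  have cardN: "N s = card {e \<in> E. filter (\<lambda>x. x \<in> set e) s = e}" for s
    unfolding N_def using finE by (simp add: Int_def)
  have N_pos: "1 \<le> N s" if s: "s \<in> permutations_of_set V" for s
  proof -
    obtain e where "e \<in> E" "filter (\<lambda>x. x \<in> set e) s = e"
      using property_O_filter[OF O _ s] E by blast
    then have "{e \<in> E. filter (\<lambda>x. x \<in> set e) s = e} \<noteq> {}" by blast
    then show ?thesis using finE by (simp add: cardN Suc_le_eq card_gt_0_iff)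
  qed
  \<comment> \<open>Double counting of consistent pairs; the factor \<open>fact k\<close> introduced
    next avoids division.\<close>
  have "(\<Sum>s\<in>permutations_of_set V. N s)
      = (\<Sum>e\<in>E. card {s \<in> permutations_of_set V. filter (\<lambda>x. x \<in> set e) s = e})"
    unfolding N_def by (subst sum.swap) (simp add: Int_def V)
  then have "fact k * (\<Sum>s\<in>permutations_of_set V. N s)
      = (\<Sum>e\<in>E. fact k * card {s \<in> permutations_of_set V. filter (\<lambda>x. x \<in> set e) s = e})"
    by (simp add: sum_distrib_left)
  also have "\<dots> = (\<Sum>e\<in>E. fact (card V))"
  proof (rule sum.cong)
    fix e assume "e \<in> E"
    then have "k = card (set e)" "set e \<subseteq> V" "e \<in> permutations_of_set (set e)"
      using E by (auto simp: permutations_of_set_def distinct_card)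
    then show "fact k * card {s \<in> permutations_of_set V. filter (\<lambda>x. x \<in> set e) s = e}
        = fact (card V)"
      using fact_mult_card_filter_permutations[OF V] by simp
  qed simp
  also have "\<dots> \<le> fact k * fact (card V)" using le by simp
  finally have sumN: "(\<Sum>s\<in>permutations_of_set V. N s) \<le> fact (card V)" by simp
  \<comment> \<open>Each value is at least 1 and the mean is at most 1.\<close>
  have N1: "N s = 1" if s: "s \<in> permutations_of_set V" for s
  proof (rule ccontr)
    assume "N s \<noteq> 1"
    with N_pos[OF s] have "1 < N s" by linarith
    then have "(\<Sum>s\<in>permutations_of_set V. 1) < (\<Sum>s\<in>permutations_of_set V. N s)"
      by (intro sum_strict_mono_ex1 ballI bexI[of _ s]) (simp_all add: N_pos s V del: One_nat_def sum_constant)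
    also have "\<dots> \<le> fact (card V)" by (rule sumN)
    also have "fact (card V) = (\<Sum>s\<in>permutations_of_set V. 1)"
      using card_permutations_of_set[OF V] by simp
    finally show False by (rule less_irrefl[THEN notE])
  qed
  obtain s0 where "set s0 = V" "distinct s0" using finite_distinct_list[OF V] by blast
  then have s0: "s0 \<in> permutations_of_set V" by (rule permutations_of_setI)
  obtain e0 where e0: "e0 \<in> E" using property_O_filter[OF O _ s0] E by blast
  \<comment> \<open>Appending \<open>R\<close> completes each word of the bracket of
    \<open>e0\<close> to a permutation of \<open>V\<close>.\<close>
  obtain R where R: "set R = V - set e0" "distinct R"
    using finite_distinct_list[of "V - set e0"] V by auto
  define F where "F e w = (of_bool (filter (\<lambda>x. x \<in> set e) (w @ R) = e) :: int)" for e w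
  have len: "2 \<le> length e0" and "e0 \<noteq> []" using E[OF e0] k by auto
  have other: "lie_eval e0 (F e) = 0" if e: "e \<in> E" "e \<noteq> e0" for e
  proof -
    \<comment> \<open>Vertex sets of equal size that differ cannot contain one another.\<close>
    have "card (set e) = card (set e0)" using E e e0 by (simp add: distinct_card)
    then have "\<not> set e0 \<subseteq> set e"
      using inj[OF e(1) e0 e(2)] by (metis List.finite_set card_subset_eq)
    then obtain y where y: "y \<in> set e0" "y \<notin> set e" by blast
    \<comment> \<open>As \<open>y\<close> is not in \<open>e\<close>, consistency with
      \<open>e\<close> is unaffected by deleting \<open>y\<close>.\<close>
    have "filter (\<lambda>x. x \<in> set e) w = filter (\<lambda>x. x \<in> set e) (filter (\<lambda>x. x \<noteq> y) w)" for w
      using y by (auto intro!: filter_cong)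
    then have "F e w = F e w'" if "filter (\<lambda>x. x \<noteq> y) w = filter (\<lambda>x. x \<noteq> y) w'" for w w'
      unfolding F_def filter_append using that by metis
    then show ?thesis by (rule lie_eval_eq_0[OF len y(1)])
  qed
  have self: "lie_eval e0 (F e0) = 1"
  proof -
    have "lie_eval e0 (F e0) = lie_eval e0 (\<lambda>w. of_bool (w = e0))"
    proof (rule lie_eval_cong)
      fix w assume "mset w = mset e0"
      then have "set w = set e0" by (rule mset_eq_setD)
      then have "filter (\<lambda>x. x \<in> set e0) w = w" "filter (\<lambda>x. x \<in> set e0) R = []"
        using R by (auto simp: filter_id_conv filter_empty_conv)
      then show "F e0 w = of_bool (w = e0)" by (simp add: F_def)
    qed
    then show ?thesis using lie_eval_self[of e0] E[OF e0] \<open>e0 \<noteq> []\<close> by simp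
  qed
  \<comment> \<open>The signed sum of \<open>N\<close> is evaluated twice: edge by edge it is 1, as
    that of a constant it is 0.\<close>
  have "1 = (\<Sum>e\<in>E. lie_eval e0 (F e))"
    using other self finE e0 by (subst sum.remove[of _ e0]) auto
  also have "\<dots> = lie_eval e0 (\<lambda>w. \<Sum>e\<in>E. F e w)" by (rule lie_eval_sum[symmetric])
  also have "\<dots> = lie_eval e0 (\<lambda>w. 1)"
  proof (rule lie_eval_cong)
    fix w assume w: "mset w = mset e0"
    then have "set w = set e0" "distinct w"
      using E[OF e0] mset_eq_setD mset_eq_imp_distinct_iff by blast+
    then have "w @ R \<in> permutations_of_set V"
      using R E[OF e0] by (auto simp: permutations_of_set_def)
    then have "int (N (w @ R)) = 1" using N1 by simp
    then show "(\<Sum>e\<in>E. F e w) = 1" by (simp add: N_def F_def of_nat_sum)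
  qed
  \<comment> \<open>A constant ignores every letter, so any letter of \<open>e0\<close> would do in
    place of \<open>hd e0\<close>.\<close>
  also have "\<dots> = 0"
    using lie_eval_eq_0[OF len, of "hd e0" "\<lambda>_. 1"] \<open>e0 \<noteq> []\<close> by simp
  finally show False by simp
qed

section \<open>The upper bound\<close>

text \<open>The vertices are a base set of \<open>k - 1\<close> vertices \<open>Base i\<close>, and, for each linear order
  \<open>t\<close> of their indices, a vertex \<open>Pivot t\<close> and a vertex \<open>Spare t q\<close> to be used if
  \<open>Pivot t\<close> has exactly \<open>q\<close> base vertices below it. They are coded as natural numbers because
  \<open>min_edges\<close> is an infimum over graphs on natural numbers, which has to be shown to be over a
  nonempty set.\<close>

definition Base :: "nat \<Rightarrow> nat" where
  "Base i = prod_encode (0, i)"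

definition Pivot :: "nat list \<Rightarrow> nat" where
  "Pivot t = prod_encode (1, list_encode t)"

text \<open>The tags 0 and 1 are taken by \<open>Base\<close> and \<open>Pivot\<close>.\<close>

definition Spare :: "nat list \<Rightarrow> nat \<Rightarrow> nat" where
  "Spare t q = prod_encode (q + 2, list_encode t)"

lemma vertex_inject [simp]:
  "Base i = Base i' \<longleftrightarrow> i = i'"
  "Pivot t = Pivot t' \<longleftrightarrow> t = t'"
  "Spare t q = Spare t' q' \<longleftrightarrow> t = t' \<and> q = q'"
  by (auto simp: Base_def Pivot_def Spare_def list_encode_eq)

lemma vertex_distinct [simp]:
  "Base i \<noteq> Pivot t" "Base i \<noteq> Spare t' q" "Pivot t \<noteq> Spare t' q"
  "Pivot t \<noteq> Base i" "Spare t' q \<noteq> Base i" "Spare t' q \<noteq> Pivot t"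
  by (auto simp: Base_def Pivot_def Spare_def)

definition chain :: "nat list \<Rightarrow> nat \<Rightarrow> nat list" where
  "chain t q = take q (map Base t) @ Pivot t # drop q (map Base t)"

text \<open>Replacing the \<open>j\<close>-th entry of a chain by a further vertex \<open>c\<close> gives a chain if \<open>c\<close>
  lies in one of the two gaps next to that entry; the positions below thus account for every gap.\<close>

definition positions :: "nat \<Rightarrow> nat set" where
  "positions k = insert (k - 1) ((\<lambda>i. 2 * i) ` {..<k div 2})"

definition O_vertices :: "nat \<Rightarrow> nat set" where
  "O_vertices k = Base ` {..<k - 1} \<union> Pivot ` permutations_of_set {..<k - 1} \<union>
     case_prod Spare ` (permutations_of_set {..<k - 1} \<times> {..<k - 1})"

text \<open>For \<open>q = k - 1\<close> the chain is itself an edge, so spare vertices occur only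
  for smaller \<open>q\<close>.\<close>

definition O_edges :: "nat \<Rightarrow> nat list set" where
  "O_edges k = (\<lambda>t. chain t (k - 1)) ` permutations_of_set {..<k - 1} \<union>
     (\<lambda>(t, q, j). (chain t q)[j := Spare t q]) `
       (permutations_of_set {..<k - 1} \<times> {..<k - 1} \<times> positions k)"

lemma finite_positions: "finite (positions k)"
  by (simp add: positions_def)

lemma card_positions_le: "card (positions k) \<le> k div 2 + 1"
proof -
  have "card ((\<lambda>i. 2 * i) ` {..<k div 2}) \<le> k div 2"
    using card_image_le[of "{..<k div 2}" "\<lambda>i. 2 * i"] by simp
  then show ?thesis unfolding positions_def
    using card_insert_le_m1[of "k div 2 + 1"] by simp
qed

lemma positions_less: "0 < k \<Longrightarrow> j \<in> positions k \<Longrightarrow> j < k"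
  by (auto simp: positions_def)

text \<open>Position \<open>2 * i\<close> serves the gaps \<open>2 * i\<close> and
  \<open>2 * i + 1\<close>, and position \<open>k - 1\<close> serves the last two gaps.\<close>

lemma positions_gap:
  assumes "0 < k" "g \<le> k"
  obtains j where "j \<in> positions k" "g = j \<or> g = Suc j"
proof (cases "even g \<and> g div 2 < k div 2 \<or> odd g")
  case True
  have "2 * (g div 2) \<in> positions k"
  proof (cases "g div 2 < k div 2")
    case False
    then have "2 * (g div 2) = k - 1" using True assms by presburger
    then show ?thesis by (simp add: positions_def)
  qed (simp add: positions_def)
  moreover have "g = 2 * (g div 2) \<or> g = Suc (2 * (g div 2))" by presburger
  ultimately show ?thesis by (rule that)
next
  case False
  then have "g = k - 1 \<or> g = Suc (k - 1)" using assms by presburger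
  then show ?thesis using that[of "k - 1"] by (simp add: positions_def)
qed

section \<open>The construction is an oriented k-graph\<close>

lemma set_chain: "set (chain t q) = insert (Pivot t) (Base ` set t)"
  unfolding chain_def set_take_insert_drop by simp

lemma length_chain: "length (chain t q) = Suc (length t)"
  by (simp add: chain_def)

lemma distinct_chain: "distinct t \<Longrightarrow> distinct (chain t q)"
  unfolding chain_def distinct_take_insert_drop by (auto simp: distinct_map inj_on_def)

lemma set_chain_update:
  assumes "distinct t" "j \<le> length t"
  shows "set ((chain t q)[j := Spare t q])
       = insert (Spare t q) (insert (Pivot t) (Base ` set t) - {chain t q ! j})"
  using set_update_distinct[OF distinct_chain[OF assms(1)], of j q "Spare t q"] assms
  by (simp add: length_chain set_chain)

lemma distinct_chain_update:
  "distinct t \<Longrightarrow> distinct ((chain t q)[j := Spare t q])"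
  by (intro distinct_list_update distinct_chain) (auto simp: set_chain)

lemma permutations_lessThanD:
  "t \<in> permutations_of_set {..<n} \<Longrightarrow> set t = {..<n} \<and> distinct t \<and> length t = n"
  by (metis permutations_of_setD card_lessThan distinct_card)

text \<open>An edge can be recovered from its vertex set: a spare vertex reveals \<open>t\<close>
  and \<open>q\<close>, and the missing chain entry then reveals the position; without a spare
  vertex, the pivot reveals \<open>t\<close>.\<close>

lemma oriented_graph_O:
  assumes k: "0 < k"
  shows "oriented_graph k (O_vertices k) (O_edges k)"
proof -
  let ?P = "permutations_of_set {..<k - 1}"
  have j: "j \<le> k - 1" if "j \<in> positions k" for j
    using positions_less[OF k that] by simp
  have 1: "length e = k \<and> set e \<subseteq> O_vertices k \<and> distinct e" if "e \<in> O_edges k" for e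
    using that unfolding O_edges_def
  proof (elim UnE imageE)
    fix t assume "e = chain t (k - 1)" "t \<in> ?P"
    then show ?thesis using permutations_lessThanD[of t "k - 1"] k
      by (auto simp: length_chain set_chain distinct_chain O_vertices_def)
  next
    fix p assume p: "e = (case p of (t, q, j) \<Rightarrow> (chain t q)[j := Spare t q])"
      "p \<in> ?P \<times> {..<k - 1} \<times> positions k"
    obtain t q i where tqi: "p = (t, q, i)" by (cases p)
    with p have e: "e = (chain t q)[i := Spare t q]" "t \<in> ?P" "q < k - 1" "i \<in> positions k"
      by auto
    then show ?thesis using permutations_lessThanD[of t "k - 1"] k j[of i]
      by (auto simp: length_chain set_chain_update distinct_chain_update O_vertices_def)
  qed
  have 2: "e = e'" if "e \<in> O_edges k" "e' \<in> O_edges k" "set e = set e'" for e e'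
  proof -
    have pv: "(\<exists>t\<in>?P. e = chain t (k - 1) \<and> set e = insert (Pivot t) (Base ` set t)) \<or>
       (\<exists>t\<in>?P. \<exists>q i. i \<le> k - 1 \<and> e = (chain t q)[i := Spare t q] \<and>
         set e = insert (Spare t q) (insert (Pivot t) (Base ` set t) - {chain t q ! i}))"
      if "e \<in> O_edges k" for e
      using that unfolding O_edges_def
    proof (elim UnE imageE)
      fix t assume "e = chain t (k - 1)" "t \<in> ?P"
      then show ?thesis by (auto simp: set_chain)
    next
      fix p assume p: "e = (case p of (t, q, j) \<Rightarrow> (chain t q)[j := Spare t q])"
        "p \<in> ?P \<times> {..<k - 1} \<times> positions k"
      obtain t q i where tqi: "p = (t, q, i)" by (cases p)
      with p have e: "e = (chain t q)[i := Spare t q]" "t \<in> ?P" "i \<le> k - 1"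
        using j by auto
      then have "set e = insert (Spare t q) (insert (Pivot t) (Base ` set t) - {chain t q ! i})"
        using permutations_lessThanD[of t "k - 1"] by (simp add: set_chain_update)
      then show ?thesis using e by blast
    qed
    from pv[OF that(1)] pv[OF that(2)] show ?thesis
    proof (elim disjE bexE exE conjE)
      fix t t' assume "set e = insert (Pivot t) (Base ` set t)"
        "set e' = insert (Pivot t') (Base ` set t')"
        "e = chain t (k - 1)" "e' = chain t' (k - 1)"
      moreover from this have "Pivot t \<in> insert (Pivot t') (Base ` set t')"
        using that(3) by blast
      ultimately show ?thesis by auto
    next
      fix t t' q q' i i'
      assume a: "t \<in> ?P" "i \<le> k - 1" "i' \<le> k - 1"
        "set e = insert (Spare t q) (insert (Pivot t) (Base ` set t) - {chain t q ! i})"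
        "set e' = insert (Spare t' q') (insert (Pivot t') (Base ` set t') - {chain t' q' ! i'})"
        "e = (chain t q)[i := Spare t q]" "e' = (chain t' q')[i' := Spare t' q']"
      have "Spare t q \<in> set e'" using a(4) that(3) by blast
      then have tq: "t' = t" "q' = q" using a(5) by auto
      have len: "length (chain t q) = k" "distinct (chain t q)"
        using permutations_lessThanD[OF a(1)] k by (auto simp: length_chain distinct_chain)
      have "chain t q ! i \<in> insert (Pivot t) (Base ` set t)"
        "chain t q ! i' \<in> insert (Pivot t) (Base ` set t)"
        using len a(2,3) k by (auto simp flip: set_chain[of t q])
      moreover have "Spare t q \<notin> insert (Pivot t) (Base ` set t)" by auto
      \<comment> \<open>The entry replaced in \<open>e\<close> would survive in \<open>e'\<close> if
        a different one were replaced there.\<close>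
      ultimately have "chain t q ! i \<notin> set e"
        "chain t q ! i \<noteq> chain t q ! i' \<Longrightarrow> chain t q ! i \<in> set e'"
        using a(4,5) unfolding tq by auto
      then have "chain t q ! i = chain t q ! i'" using that(3) by blast
      then have "i = i'" using len a(2,3) k by (simp add: nth_eq_iff_index_eq)
      then show ?thesis using a(6,7) tq by simp
    next
      fix t t' q i
      assume "set e = insert (Pivot t) (Base ` set t)"
        "set e' = insert (Spare t' q) (insert (Pivot t') (Base ` set t') - {chain t' q ! i})"
      then have "Spare t' q \<in> insert (Pivot t) (Base ` set t)" using that(3) by blast
      then show ?thesis by auto
    next
      fix t t' q i
      assume "set e' = insert (Pivot t) (Base ` set t)"
        "set e = insert (Spare t' q) (insert (Pivot t') (Base ` set t') - {chain t' q ! i})"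
      then have "Spare t' q \<in> insert (Pivot t) (Base ` set t)" using that(3) by blast
      then show ?thesis by auto
    qed
  qed
  have "finite (O_vertices k)" by (simp add: O_vertices_def)
  then show ?thesis unfolding oriented_graph_def using 1 2 by blast
qed

section \<open>The construction has Property O\<close>

lemma sorted_wrt_update_gap:
  assumes "sorted_wrt P xs" "\<And>i. i < g \<Longrightarrow> P (xs ! i) c"
    "\<And>i. g \<le> i \<Longrightarrow> i < length xs \<Longrightarrow> P c (xs ! i)" "g = j \<or> g = Suc j"
  shows "sorted_wrt P (xs[j := c])"
proof (cases "j < length xs")
  case True
  \<comment> \<open>For both values of \<open>g\<close>, indices before \<open>j\<close> are below
    \<open>g\<close> and indices after \<open>j\<close> are at least \<open>g\<close>.\<close>
  then show ?thesis using assms by (auto simp: sorted_wrt_iff_nth_less nth_list_update)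
next
  case False
  then show ?thesis using assms(1) by (simp add: list_update_beyond)
qed

lemma property_O_O:
  assumes k: "0 < k"
  shows "property_O (O_vertices k) (O_edges k)"
  unfolding property_O_def
proof (intro allI impI, elim conjE)
  fix r assume r: "strict_linear_order_on (O_vertices k) r"
  let ?P = "\<lambda>x y. (x, y) \<in> r"
  have "Base ` {..<k - 1} \<subseteq> O_vertices k" by (auto simp: O_vertices_def)
  then obtain xs where xs: "set xs = Base ` {..<k - 1}" "distinct xs" "sorted_wrt ?P xs"
    using strict_linear_order_sorted_list[OF r, of "Base ` {..<k - 1}"] by blast
  \<comment> \<open>\<open>t\<close> records how \<open>r\<close> arranges the base vertices, which
    selects the pivot to look at.\<close>
  then obtain t where t: "xs = map Base t" using ex_map_conv[of xs Base] by blast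
  then have "set t = {..<k - 1}" "distinct t"
    using xs by (auto simp: distinct_map inj_image_eq_iff[of Base] inj_def)
  then have tP: "t \<in> permutations_of_set {..<k - 1}" by (simp add: permutations_of_set_def)
  then have len: "length t = k - 1" using permutations_lessThanD by blast
  have p: "set xs \<subseteq> O_vertices k" "Pivot t \<in> O_vertices k" "Pivot t \<notin> set xs"
    using xs tP by (auto simp: O_vertices_def)
  obtain q where q: "q \<le> length xs" "\<And>i. i < q \<Longrightarrow> (xs ! i, Pivot t) \<in> r"
    "\<And>i. q \<le> i \<Longrightarrow> i < length xs \<Longrightarrow> (Pivot t, xs ! i) \<in> r"
    by (rule sorted_wrt_gap[OF r xs(3) p]) blast
  have s: "sorted_wrt ?P (chain t q)"
    unfolding chain_def t[symmetric] using sorted_wrt_insert_at[OF xs(3), of q "Pivot t"] q by blast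
  show "\<exists>e\<in>O_edges k. consistent e r"
  proof (cases "q = k - 1")
    case True
    then have "chain t q \<in> O_edges k" using tP by (auto simp: O_edges_def)
    then show ?thesis using s by (auto simp: consistent_def)
  next
    case False
    then have qk: "q < k - 1" using q(1) t len by simp
    have c: "set (chain t q) \<subseteq> O_vertices k" "Spare t q \<in> O_vertices k"
      "Spare t q \<notin> set (chain t q)"
      using tP qk p xs t by (auto simp: set_chain O_vertices_def)
    \<comment> \<open>\<open>g\<close> is the gap of the chain in which the spare vertex
      lies.\<close>
    obtain g where g: "g \<le> length (chain t q)"
      "\<And>i. i < g \<Longrightarrow> (chain t q ! i, Spare t q) \<in> r"
      "\<And>i. g \<le> i \<Longrightarrow> i < length (chain t q) \<Longrightarrow> (Spare t q, chain t q ! i) \<in> r"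
      by (rule sorted_wrt_gap[OF r s c]) blast
    have "g \<le> k" using g(1) len k by (simp add: length_chain)
    then obtain j where j: "j \<in> positions k" "g = j \<or> g = Suc j"
      using positions_gap[OF k] by blast
    have "consistent ((chain t q)[j := Spare t q]) r"
      unfolding consistent_def by (rule sorted_wrt_update_gap[OF s g(2,3) j(2)])
    moreover have "(chain t q)[j := Spare t q] \<in> O_edges k"
      using tP qk j(1) by (force simp: O_edges_def)
    ultimately show ?thesis by blast
  qed
qed

section \<open>Counting edges and the final bounds\<close>

lemma card_O_edges_le:
  "card (O_edges k) \<le> fact (k - 1) * (1 + (k - 1) * (k div 2 + 1))"
proof -
  let ?P = "permutations_of_set {..<k - 1}"
  have "card (O_edges k) \<le> card ?P + card (?P \<times> {..<k - 1} \<times> positions k)"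
    unfolding O_edges_def
    by (intro order_trans[OF card_Un_le] add_mono card_image_le) (auto simp: finite_positions)
  also have "\<dots> = fact (k - 1) * (1 + (k - 1) * card (positions k))"
    by (simp add: card_cartesian_product)
  also have "\<dots> \<le> fact (k - 1) * (1 + (k - 1) * (k div 2 + 1))"
    by (intro mult_le_mono add_mono card_positions_le order_refl)
  finally show ?thesis .
qed

theorem theorem1p3:
  fixes k :: nat
  assumes "k \<ge> 3"
  shows "fact k + 1 \<le> min_edges k \<and>
    int (min_edges k) \<le> (\<lfloor>real k / 2\<rfloor> + 1) * fact k - \<lfloor>real k / 2\<rfloor> * fact (k - 1)"
proof
  have k: "0 < k" "2 \<le> k" using assms by auto
  note O = oriented_graph_O[OF k(1)] property_O_O[OF k(1)]
  let ?S = "{card E |(V :: nat set) E. oriented_graph k V E \<and> property_O V E}"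
  \<comment> \<open>Nonemptiness makes the infimum an attained minimum instead of the default
    0.\<close>
  have "?S \<noteq> {}" using O by blast
  then have "min_edges k \<in> ?S" unfolding min_edges_def by (rule Inf_nat_def1)
  then show "fact k + 1 \<le> min_edges k"
    using fact_less_card_edges[OF k(2)] by fastforce
  have "int (min_edges k) \<le> int (fact (k - 1) * (1 + (k - 1) * (k div 2 + 1)))"
    using min_edges_le_card[OF O] card_O_edges_le[of k] by linarith
  \<comment> \<open>With \<open>m = k div 2\<close>, this is
    \<open>1 + (k - 1) * (m + 1) = (m + 1) * k - m\<close>, multiplied by
    \<open>fact (k - 1)\<close>.\<close>
  also have "\<dots> = (int (k div 2) + 1) * (int k * fact (k - 1)) - int (k div 2) * fact (k - 1)"
  proof -
    obtain n where "k = Suc n" using k by (cases k) auto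
    then show ?thesis by (simp add: algebra_simps)
  qed
  also have "int k * fact (k - 1) = fact k"
    using k by (simp add: fact_reduce[of k])
  also have "int (k div 2) = \<lfloor>real k / 2\<rfloor>"
    using floor_divide_of_nat_eq[of k 2, where ?'a = real] by simp
  finally show "int (min_edges k) \<le> (\<lfloor>real k / 2\<rfloor> + 1) * fact k - \<lfloor>real k / 2\<rfloor> * fact (k - 1)" .
qed

end
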